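(* Let $m$ be an odd positive integer and let $F:\mathbb{F}_{2^m}^3\to\mathbb{F}_{2^m}^3$ be defined by $F(x,y,z)=(f(x,y,z),f(y,z,x),f(z,x,y))$, where $f(x,y,z)=x^3+x^2y+xy^2+x^2z+yz^2$. Then $F$ is a permutation of $\mathbb{F}_{2^m}^3$.
   Context: $\mathbb{F}_{2^m}$ denotes the finite field with $2^m$ elements and $\mathbb{F}_{2^m}^3$ the 3-dimensional vector space over it. A permutation of $\mathbb{F}_{2^m}^3$ is a bijection from $\mathbb{F}_{2^m}^3$ to itself. *)

theory Defs
  imports Main "HOL-Library.Cardinality"
begin

definition f_cubic :: "'a::field \<Rightarrow> 'a \<Rightarrow> 'a \<Rightarrow> 'a" where
  "f_cubic x y z = x ^ 3 + x ^ 2 * y + x * y ^ 2 + x ^ 2 * z + y * z ^ 2"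

definition F_cubic :: "'a::field \<times> 'a \<times> 'a \<Rightarrow> 'a \<times> 'a \<times> 'a" where
  "F_cubic = (\<lambda>(x, y, z). (f_cubic x y z, f_cubic y z x, f_cubic z x y))"

end

theory Submission imports
  Defs
  "HOL-Number_Theory.Residues"
begin

text \<open>
  In characteristic 2, the coordinates of \<open>F\<close> sum to \<open>(x + y + z)\<^sup>3\<close>. Cubing is injective because
  \<open>u\<^sup>2 + uv + v\<^sup>2\<close> is anisotropic for odd \<open>m\<close> (there is no primitive cube root of unity), so two points
  with the same image differ by some \<open>(a, b, a + b)\<close>. As \<open>F\<close> has algebraic degree 2,
  \<open>F(X + A) - F(X)\<close> is affine over the prime field in \<open>X\<close>, and the combination of its first two coordinates with
  weights \<open>a\<close> and \<open>a + b\<close> is \<open>T\<^sup>2 + TQ + Q\<^sup>2\<close> with \<open>Q = a\<^sup>2 + ab + b\<^sup>2\<close>. Anisotropy, applied twice,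
  forces \<open>Q = 0\<close> and then \<open>a = b = 0\<close>.
\<close>

text \<open>Multiplication by \<open>x \<noteq> 0\<close> permutes the nonzero elements and so
  preserves their product.\<close>

lemma finite_power_card_eq:
  fixes x :: "'a::{field,finite}"
  shows "x ^ CARD('a) = x"
proof (cases "x = 0")
  case False
  let ?U = "UNIV - {0::'a}"
  have "(\<Prod>y\<in>?U. x * y) = (\<Prod>y\<in>?U. y)"
    by (rule prod.reindex_bij_witness[of _ "\<lambda>y. y / x" "\<lambda>y. x * y"]) (use False in auto)
  then have "x ^ card ?U * (\<Prod>y\<in>?U. y) = 1 * (\<Prod>y\<in>?U. y)"
    by (simp only: prod.distrib prod_constant mult_1)
  moreover have "(\<Prod>y\<in>?U. y) \<noteq> 0" by simp
  ultimately have "x ^ card ?U = 1"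
    using mult_right_cancel by blast
  moreover have "CARD('a) = Suc (card ?U)"
    by (rule card.remove) auto
  ultimately show ?thesis by (simp only: power_Suc mult_1_right)
qed simp

lemma two_eq_0:
  assumes "CARD('a::{field,finite}) = 2 ^ m"
  shows "(2::'a) = 0"
proof -
  have "of_nat CARD('a) = (0::'a)"
    by (simp add: of_nat_eq_0_iff_char_dvd CHAR_dvd_CARD)
  with assms show ?thesis by simp
qed

text \<open>The second equation cancels equal neighbours inside a sorted, right-nested sum.\<close>

lemma char_two_simps:
  fixes x y :: "'a::field"
  assumes two: "(2::'a) = 0"
  shows "x + x = 0" and "x + (x + y) = y" and "x - y = x + y"
proof -
  show *: "x + x = 0" for x :: 'a
    using two mult_2[of x] by simp
  show "x + (x + y) = y" "x - y = x + y"
    using *[of x] *[of y] by (simp_all add: diff_eq_eq add.assoc flip: add.assoc[of x x y])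
qed

text \<open>If \<open>v \<noteq> 0\<close>, squaring swaps \<open>t = u / v\<close> with
  \<open>t ^ 2\<close>, whereas \<open>m\<close> squarings fix every element.\<close>

lemma quadratic_form_eq_0D:
  fixes u v :: "'a::{field,finite}"
  assumes "odd m" and "CARD('a) = 2 ^ m" and eq: "u ^ 2 + u * v + v ^ 2 = 0"
  shows "u = 0 \<and> v = 0"
proof (cases "v = 0")
  case False
  define t where "t = u / v"
  have two: "(2::'a) = 0" by (rule two_eq_0) fact
  have t: "t ^ 2 + t + 1 = 0"
    using eq False unfolding t_def by (simp add: field_simps power2_eq_square)
  have t2: "t ^ 2 = t + 1"
    using t by (simp add: add.assoc add_eq_0_iff2 char_two_simps[OF two])
  have "(t - 1) * (t ^ 2 + t + 1) = t ^ 3 - 1"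
    by (simp add: algebra_simps power2_eq_square power3_eq_cube)
  with t have "t ^ 3 = 1" by simp
  then have t4: "t ^ 4 = t" by (simp add: numeral_eq_Suc)
  \<comment> \<open>Two squarings fix \<open>t\<close>, so an odd number of them acts as
    one.\<close>
  have "t ^ 2 ^ (2 * k + 1) = t ^ 2" for k
  proof (induction k)
    case (Suc k)
    have "t ^ 2 ^ (2 * Suc k + 1) = (t ^ 2 ^ (2 * k + 1)) ^ 4"
      by (simp flip: power_mult)
    also have "\<dots> = (t ^ 4) ^ 2" using Suc by (simp flip: power_mult)
    finally show ?case using t4 by simp
  qed simp
  then have "t ^ 2 = t"
    using finite_power_card_eq[of t] assms(1,2) by (metis oddE)
  with t2 have "(1::'a) = 0" by simp
  then show ?thesis by simp
qed (use eq in simp)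

lemma f_cubic_cyclic_sum:
  assumes "(2::'a::field) = 0"
  shows "f_cubic x y z + f_cubic y z x + f_cubic z x y = (x + y + z :: 'a) ^ 3"
  by (simp add: f_cubic_def algebra_simps power2_eq_square power3_eq_cube char_two_simps[OF assms])

text \<open>The weights turn the terms quadratic in \<open>x, y, z\<close> into a square: in
  characteristic 2, \<open>T\<close> is \<open>(a + b) * x + a * y + b * z\<close>. The linear terms
  then give \<open>T * Q\<close>, the constant ones \<open>Q ^ 2\<close>.\<close>

lemma f_cubic_difference_combination:
  fixes x y z a b :: "'a::field"
  assumes "(2::'a) = 0"
  defines "T \<equiv> a * x + (a + b) * y + b * (x + y + z)"
    and "Q \<equiv> a ^ 2 + a * b + b ^ 2"
  shows "a * (f_cubic (x + a) (y + b) (z + (a + b)) - f_cubic x y z)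
      + (a + b) * (f_cubic (y + b) (z + (a + b)) (x + a) - f_cubic y z x)
    = T ^ 2 + T * Q + Q ^ 2"
  unfolding T_def Q_def f_cubic_def char_two_simps(3)[OF assms(1)]
  by (simp only: distrib_left distrib_right power2_eq_square power3_eq_cube ac_simps
      char_two_simps(1,2)[OF assms(1)] add_0_left add_0_right)

theorem theorem2:
  fixes m :: nat
  assumes "0 < m" and "odd m"
    and "CARD('a::{field,finite}) = 2 ^ m"
  shows "bij (F_cubic :: 'a \<times> 'a \<times> 'a \<Rightarrow> 'a \<times> 'a \<times> 'a)"
proof -
  note form0 = quadratic_form_eq_0D[OF assms(2,3)]
  have two: "(2::'a) = 0" by (rule two_eq_0) fact
  have inj: "x = x' \<and> y = y' \<and> z = z'"
    if eq: "f_cubic x y z = f_cubic x' y' z'" "f_cubic y z x = f_cubic y' z' x'"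
      "f_cubic z x y = f_cubic z' x' y'" for x y z x' y' z' :: 'a
  proof -
    define s s' where "s = x + y + z" and "s' = x' + y' + z'"
    have "s ^ 3 = s' ^ 3"
      using eq f_cubic_cyclic_sum[OF two, of x y z] f_cubic_cyclic_sum[OF two, of x' y' z']
      by (simp add: s_def s'_def)
    then have "(s - s') * (s ^ 2 + s * s' + s' ^ 2) = 0"
      by (simp add: algebra_simps power2_eq_square power3_eq_cube)
    then have "s = s'" using form0[of s s'] by auto
    define a b where "a = x' - x" and "b = y' - y"
    have x': "x' = x + a" and y': "y' = y + b" by (simp_all add: a_def b_def)
    \<comment> \<open>Equal sums give \<open>z' - z = - (a + b)\<close>, and signs do not matter
      here.\<close>
    have z': "z' = z + (a + b)"
      using \<open>s = s'\<close> unfolding s_def s'_def x' y'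
      by (simp add: algebra_simps mult_2 mult_2_right two)
    define T Q where "T = a * x + (a + b) * y + b * (x + y + z)"
      and "Q = a ^ 2 + a * b + b ^ 2"
    have "T ^ 2 + T * Q + Q ^ 2 = 0"
      using f_cubic_difference_combination[OF two, of a x y b z] eq
      unfolding x' y' z' T_def Q_def by simp
    then have "Q = 0" using form0 by blast
    then have "a = 0 \<and> b = 0" using form0 unfolding Q_def by blast
    then show ?thesis by (simp add: x' y' z')
  qed
  have "inj (F_cubic :: 'a \<times> 'a \<times> 'a \<Rightarrow> _)"
  proof (rule injI)
    fix p q :: "'a \<times> 'a \<times> 'a"
    assume eq: "F_cubic p = F_cubic q"
    obtain x y z where p: "p = (x, y, z)" by (rule prod_cases3)
    obtain x' y' z' where q: "q = (x', y', z')" by (rule prod_cases3)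
    have "x = x' \<and> y = y' \<and> z = z'"
      by (rule inj) (use eq in \<open>simp_all add: F_cubic_def p q\<close>)
    then show "p = q" by (simp add: p q)
  qed
  then show ?thesis by (simp add: bij_def finite_UNIV_inj_surj)
qed

end
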